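(* Let $k>1$ be an integer, $\sigma$ a permutation of $\{0,1,\ldots,n\}$, and let $r=[a_0;a_1,\ldots,a_n]$ be a $(\sigma,k)$-permutiple with $r'=[a_{\sigma(0)};a_{\sigma(1)},\ldots,a_{\sigma(n)}]$, tails $(\gamma_j)$ of $r$ and $(\gamma'_j)$ of $r'$. The following are equivalent: (1) $r$ is perfect; (2) $k=\frac{\gamma_0}{\gamma'_0}=\frac{\gamma'_1}{\gamma_1}=\frac{\gamma_2}{\gamma'_2}=\frac{\gamma'_3}{\gamma_3}=\cdots$, i.e. $\gamma_j=k\gamma'_j$ for even $j$ and $\gamma'_j=k\gamma_j$ for odd $j$ ($0\le j\le n-1$); (3) $\frac1k G(x)=G(kx)$ for $x=\gamma'_0,\gamma_1,\gamma'_2,\gamma_3,\ldots$ (i.e. $x=\gamma'_j$ for even $j$ and $x=\gamma_j$ for odd $j$), and $G(\frac1k x)=kG(x)$ for $x=\gamma_0,\gamma'_1,\gamma_2,\gamma'_3,\ldots$ (i.e. $x=\gamma_j$ for even $j$ and $x=\gamma'_j$ for odd $j$), where $0\le j\le n-1$.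
   Context: For positive integers $a_0,\ldots,a_n$, $[a_0;a_1,\ldots,a_n]$ denotes the finite simple continued fraction $a_0+1/(a_1+1/(\cdots+1/a_n))$; all finite continued fractions are assumed in canonical form (last digit at least $2$ when there are at least two digits). For an integer $k>1$ and a permutation $\sigma$ of $\{0,\ldots,n\}$, $r=[a_0;\ldots,a_n]$ is a $(\sigma,k)$-permutiple if $r=k\,[a_{\sigma(0)};a_{\sigma(1)},\ldots,a_{\sigma(n)}]$. It is perfect if $a_j=k\,a_{\sigma(j)}$ for every even $j$ and $a_{\sigma(j)}=k\,a_j$ for every odd $j$ ($0\le j\le n$). Define $G:[0,\infty)\to[0,1)$ by $G(0)=0$ and $G(x)=\frac1x-\lfloor\frac1x\rfloor$ for $x>0$. The tails of $r$ are $\gamma_0=r-\lfloor r\rfloor$, $\gamma_{j+1}=G(\gamma_j)$; the tails $\gamma'_j$ of $r'$ are defined in the same way from $r'$. The index ranges in (2) and (3), written with "$\cdots$" in the paper, are taken as $0\le j\le n-1$. *)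

theory Defs
  imports Complex_Main "HOL-Combinatorics.Permutations"
begin

text \<open>
  A finite continued fraction is given by a digit function together with the index of its
  last digit: \<open>cfrac a n\<close> is \<open>[a 0; a 1, \<dots>, a n]\<close>. Values of \<open>a\<close> beyond index \<open>n\<close> are irrelevant.
\<close>

primrec cfrac :: "(nat \<Rightarrow> nat) \<Rightarrow> nat \<Rightarrow> real" where
  "cfrac a 0 = real (a 0)"
| "cfrac a (Suc n) = real (a 0) + 1 / cfrac (\<lambda>i. a (Suc i)) n"

definition canonical :: "(nat \<Rightarrow> nat) \<Rightarrow> nat \<Rightarrow> bool" where
  "canonical a n \<longleftrightarrow> (\<forall>j\<le>n. 0 < a j) \<and> (1 \<le> n \<longrightarrow> 2 \<le> a n)"

definition permutiple :: "(nat \<Rightarrow> nat) \<Rightarrow> nat \<Rightarrow> (nat \<Rightarrow> nat) \<Rightarrow> nat \<Rightarrow> bool" where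
  "permutiple \<sigma> k a n \<longleftrightarrow> cfrac a n = real k * cfrac (\<lambda>j. a (\<sigma> j)) n"

definition perfect :: "(nat \<Rightarrow> nat) \<Rightarrow> nat \<Rightarrow> (nat \<Rightarrow> nat) \<Rightarrow> nat \<Rightarrow> bool" where
  "perfect \<sigma> k a n \<longleftrightarrow>
     (\<forall>j\<le>n. (even j \<longrightarrow> a j = k * a (\<sigma> j)) \<and> (odd j \<longrightarrow> a (\<sigma> j) = k * a j))"

text \<open>The map is only meant for arguments in \<open>[0, \<infinity>)\<close>.\<close>

definition G :: "real \<Rightarrow> real" where
  "G x = (if x = 0 then 0 else 1 / x - of_int \<lfloor>1 / x\<rfloor>)"

primrec tail :: "real \<Rightarrow> nat \<Rightarrow> real" where
  "tail r 0 = r - of_int \<lfloor>r\<rfloor>"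
| "tail r (Suc j) = G (tail r j)"

end

theory Submission
  imports Defs
begin

text \<open>
  For \<open>j < n\<close> the tails satisfy \<open>1 / \<gamma> j = a (j + 1) + \<gamma> (j + 1)\<close>, and \<open>\<gamma> n = 0\<close>. So the ratios
  in (2) give the digit relations in (1) by comparing consecutive tails, and conversely the
  ratios follow from the digit relations by descending from \<open>n\<close>. The functional equations in (3)
  say no more than that the digits which should be multiples of \<open>k\<close> are, and that the tails
  which get multiplied by \<open>k\<close> stay below 1; hence in each step integer and fractional parts
  separate, and the ratios in (2) follow by ascending from \<open>r = k r'\<close>. At index 0 the bound is
  not among the equations: \<open>k\<close> divides the second digit of \<open>r'\<close>, so \<open>k \<gamma>' 0 \<le> 1\<close>, and equality
  would make \<open>r\<close> an integer.
\<close>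

lemma G_less_1: "G x < 1"
  unfolding G_def by simp linarith

text \<open>Dividing \<open>1 / x\<close> into integer and fractional part and scaling by
  \<open>1 / k\<close> shows that \<open>\<lfloor>1 / x\<rfloor> / k\<close> equals the integer
  \<open>\<lfloor>1 / (k * x)\<rfloor>\<close>, because the fractional parts cancel.\<close>

lemma dvd_floor_if_G_mult:
  assumes "k > 0" "x \<noteq> 0" "1 / real k * G x = G (real k * x)"
  shows "int k dvd \<lfloor>1 / x\<rfloor>"
proof -
  have "(1 / x - of_int \<lfloor>1 / x\<rfloor>) / real k = 1 / (real k * x) - of_int \<lfloor>1 / (real k * x)\<rfloor>"
    using assms by (simp add: G_def)
  hence "real_of_int \<lfloor>1 / x\<rfloor> = of_int (int k * \<lfloor>1 / (real k * x)\<rfloor>)"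
    using assms by (simp add: field_simps)
  hence "\<lfloor>1 / x\<rfloor> = int k * \<lfloor>1 / (real k * x)\<rfloor>"
    by (simp only: of_int_eq_iff)
  thus ?thesis by (rule dvdI)
qed

text \<open>Used to split an equation between digits plus tails into one for the digits and one for
  the tails.\<close>

lemma nat_plus_fraction_eq_iff:
  fixes u v :: real
  assumes "0 \<le> u" "u < 1" "0 \<le> v" "v < 1"
  shows "real p + u = real q + v \<longleftrightarrow> p = q \<and> u = v"
proof
  assume eq: "real p + u = real q + v"
  hence "real p < real (q + 1)" "real q < real (p + 1)" using assms by auto
  hence "p = q" unfolding of_nat_less_iff by simp
  thus "p = q \<and> u = v" using eq by simp
qed simp

text \<open>Meant for what follows a leading digit: there the last digit is at least 2 even when it
  is the only one, so \<open>2 \<le> c n\<close> is asked for \<open>n = 0\<close> as well, unlike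
  in \<open>canonical\<close>. The strict bound keeps the reciprocal below 1.\<close>

lemma cfrac_gt_1:
  assumes "\<forall>j\<le>n. 0 < c j" "2 \<le> c n"
  shows "cfrac c n > 1"
  using assms
proof (induction n arbitrary: c)
  case (Suc n)
  have "cfrac (\<lambda>i. c (Suc i)) n > 1" using Suc by simp
  hence "1 / cfrac (\<lambda>i. c (Suc i)) n > 0" by simp
  moreover have "real (c 0) \<ge> 1" using Suc.prems by (simp add: Suc_le_eq)
  ultimately show ?case unfolding cfrac.simps by linarith
qed simp

lemma cfrac_bounds:
  assumes "canonical c n"
  shows "real (c 0) \<le> cfrac c n" "cfrac c n < real (c 0) + 1"
proof -
  have "real (c 0) \<le> cfrac c n \<and> cfrac c n < real (c 0) + 1"
  proof (cases n)
    case (Suc m)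
    have "cfrac (\<lambda>i. c (Suc i)) m > 1"
      using assms Suc by (intro cfrac_gt_1) (auto simp: canonical_def)
    thus ?thesis using Suc by simp
  qed simp
  thus "real (c 0) \<le> cfrac c n" "cfrac c n < real (c 0) + 1" by auto
qed

lemma floor_cfrac: "canonical c n \<Longrightarrow> \<lfloor>cfrac c n\<rfloor> = int (c 0)"
  using cfrac_bounds[of c n] by (simp add: floor_eq_iff)

lemma canonical_shift: "canonical c n \<Longrightarrow> j \<le> n \<Longrightarrow> canonical (\<lambda>i. c (i + j)) (n - j)"
  by (auto simp: canonical_def)

lemma cfrac_shift:
  assumes "j < n"
  shows "cfrac (\<lambda>i. c (i + j)) (n - j)
           = real (c j) + 1 / cfrac (\<lambda>i. c (i + Suc j)) (n - Suc j)"
proof -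
  have "n - j = Suc (n - Suc j)" using assms by simp
  thus ?thesis by simp
qed

text \<open>By induction, tail \<open>j\<close> is the reciprocal of the continued fraction that
  starts at digit \<open>j + 1\<close>; \<open>G\<close> inverts it and removes the floor, which is
  that digit.\<close>

lemma tail_cfrac:
  assumes "canonical c n" "j \<le> n"
  shows "tail (cfrac c n) j = cfrac (\<lambda>i. c (i + j)) (n - j) - real (c j)"
  using assms(2)
proof (induction j)
  case 0
  show ?case using assms(1) by (simp add: floor_cfrac)
next
  case (Suc j)
  let ?y = "cfrac (\<lambda>i. c (i + Suc j)) (n - Suc j)"
  have can: "canonical (\<lambda>i. c (i + Suc j)) (n - Suc j)"
    using assms(1) Suc.prems by (rule canonical_shift)
  have "0 < c (Suc j)" using assms(1) Suc.prems by (simp add: canonical_def)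
  hence "0 < ?y" using cfrac_bounds(1)[OF can] by simp
  moreover have "tail (cfrac c n) j = 1 / ?y"
    using Suc cfrac_shift[of j n c] by simp
  ultimately show ?case
    using floor_cfrac[OF can] by (simp add: G_def)
qed

lemma cfrac_eq_plus_tail: "canonical c n \<Longrightarrow> cfrac c n = real (c 0) + tail (cfrac c n) 0"
  using tail_cfrac[of c n 0] by simp

lemma tail_cfrac_last: "canonical c n \<Longrightarrow> tail (cfrac c n) n = 0"
  using tail_cfrac[of c n n] by simp

lemma tail_cfrac_bounds:
  assumes "canonical c n" "j \<le> n"
  shows "0 \<le> tail (cfrac c n) j" "tail (cfrac c n) j < 1"
  using cfrac_bounds[OF canonical_shift[OF assms]] tail_cfrac[OF assms] by auto

lemma tail_cfrac_pos_inverse: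
  assumes "canonical c n" "j < n"
  shows "0 < tail (cfrac c n) j"
    and "1 / tail (cfrac c n) j = real (c (Suc j)) + tail (cfrac c n) (Suc j)"
proof -
  let ?y = "cfrac (\<lambda>i. c (i + Suc j)) (n - Suc j)"
  have "?y > 1"
    using assms by (intro cfrac_gt_1) (auto simp: canonical_def)
  moreover have "tail (cfrac c n) j = 1 / ?y"
    using assms tail_cfrac[of c n j] cfrac_shift[of j n c] by simp
  moreover have "tail (cfrac c n) (Suc j) = ?y - real (c (Suc j))"
    using assms tail_cfrac[of c n "Suc j"] by simp
  ultimately show "0 < tail (cfrac c n) j"
    "1 / tail (cfrac c n) j = real (c (Suc j)) + tail (cfrac c n) (Suc j)" by auto
qed

lemma mult_eq_iff_inverse_mult_eq:
  fixes x y k :: real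
  assumes "x > 0" "y > 0"
  shows "x = k * y \<longleftrightarrow> 1 / y = k * (1 / x)"
  using assms by (simp add: field_simps)

theorem theorem10:
  fixes k n :: nat and \<sigma> a :: "nat \<Rightarrow> nat" and r r' :: real and \<gamma> \<gamma>' :: "nat \<Rightarrow> real"
  assumes "k > 1"
    and "\<sigma> permutes {0..n}"
    and "canonical a n"
    and "canonical (\<lambda>j. a (\<sigma> j)) n"
    and "r = cfrac a n"
    and "r' = cfrac (\<lambda>j. a (\<sigma> j)) n"
    and "permutiple \<sigma> k a n"
    and "\<And>j. \<gamma> j = tail r j"
    and "\<And>j. \<gamma>' j = tail r' j"
  shows "(perfect \<sigma> k a n \<longleftrightarrow>
           (\<forall>j<n. (even j \<longrightarrow> real k = \<gamma> j / \<gamma>' j) \<and> (odd j \<longrightarrow> real k = \<gamma>' j / \<gamma> j)))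
       \<and> ((\<forall>j<n. (even j \<longrightarrow> real k = \<gamma> j / \<gamma>' j) \<and> (odd j \<longrightarrow> real k = \<gamma>' j / \<gamma> j)) \<longleftrightarrow>
           (\<forall>j<n. (even j \<longrightarrow> 1 / real k * G (\<gamma>' j) = G (real k * \<gamma>' j)
                              \<and> G (1 / real k * \<gamma> j) = real k * G (\<gamma> j))
                \<and> (odd j \<longrightarrow> 1 / real k * G (\<gamma> j) = G (real k * \<gamma> j)
                              \<and> G (1 / real k * \<gamma>' j) = real k * G (\<gamma>' j))))"
proof -
  note can_a = assms(3) and can_b = assms(4)
  have k: "real k > 0" "real k \<noteq> 0" using assms(1) by auto
  have \<gamma>: "\<gamma> = tail (cfrac a n)" and \<gamma>': "\<gamma>' = tail (cfrac (\<lambda>j. a (\<sigma> j)) n)"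
    using assms(5,6,8,9) by auto
  define b where "b = (\<lambda>j. a (\<sigma> j))"
  have bounds: "0 \<le> \<gamma> j" "\<gamma> j < 1" "0 \<le> \<gamma>' j" "\<gamma>' j < 1" if "j \<le> n" for j
    unfolding \<gamma> \<gamma>'
    using tail_cfrac_bounds[OF can_a that] tail_cfrac_bounds[OF can_b that] by auto
  have pos: "0 < \<gamma> j" "0 < \<gamma>' j" if "j < n" for j
    unfolding \<gamma> \<gamma>'
    using tail_cfrac_pos_inverse[OF can_a that] tail_cfrac_pos_inverse[OF can_b that] by auto
  have inv: "1 / \<gamma> j = real (a (Suc j)) + \<gamma> (Suc j)"
    "1 / \<gamma>' j = real (b (Suc j)) + \<gamma>' (Suc j)" if "j < n" for j
    unfolding \<gamma> \<gamma>' b_def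
    using tail_cfrac_pos_inverse[OF can_a that] tail_cfrac_pos_inverse[OF can_b that] by auto
  have last: "\<gamma> n = 0" "\<gamma>' n = 0"
    unfolding \<gamma> \<gamma>' using tail_cfrac_last[OF can_a] tail_cfrac_last[OF can_b] by auto
  have G: "G (\<gamma> j) = \<gamma> (Suc j)" "G (\<gamma>' j) = \<gamma>' (Suc j)" for j
    unfolding \<gamma> \<gamma>' by simp_all
  \<comment> \<open>The permutiple equation \<open>r = k * r'\<close>, with the leading digits split
    off.\<close>
  have start: "real (a 0) + \<gamma> 0 = real (k * b 0) + real k * \<gamma>' 0"
  proof -
    have "real (a 0) + \<gamma> 0 = real k * (real (b 0) + \<gamma>' 0)"
      using assms(7) unfolding permutiple_def \<gamma> \<gamma>' b_def
        cfrac_eq_plus_tail[OF can_a, symmetric] cfrac_eq_plus_tail[OF can_b, symmetric] .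
    thus ?thesis by (simp add: distrib_left)
  qed

  \<comment> \<open>\<open>D\<close>, \<open>P\<close> and \<open>Q\<close> are the three conditions
    at a single index. In \<open>P\<close> the ratios are cleared of denominators, so that it also
    makes sense at \<open>n\<close>, where both tails vanish.\<close>
  define D where
    "D j \<longleftrightarrow> (even j \<longrightarrow> a j = k * b j) \<and> (odd j \<longrightarrow> b j = k * a j)" for j
  define P where
    "P j \<longleftrightarrow> (even j \<longrightarrow> \<gamma> j = real k * \<gamma>' j) \<and> (odd j \<longrightarrow> \<gamma>' j = real k * \<gamma> j)" for j
  define Q where
    "Q j \<longleftrightarrow> (even j \<longrightarrow> 1 / real k * G (\<gamma>' j) = G (real k * \<gamma>' j)
                              \<and> G (1 / real k * \<gamma> j) = real k * G (\<gamma> j))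
                \<and> (odd j \<longrightarrow> 1 / real k * G (\<gamma> j) = G (real k * \<gamma> j)
                              \<and> G (1 / real k * \<gamma>' j) = real k * G (\<gamma>' j))" for j

  \<comment> \<open>Taking reciprocals moves the factor \<open>k\<close> to the other fraction,
    which is why the relations alternate with parity; \<open>inv\<close> then brings in the next
    digit and tail.\<close>
  have P_step: "P j \<longleftrightarrow>
      (if even j then real (b (Suc j)) + \<gamma>' (Suc j) = real (k * a (Suc j)) + real k * \<gamma> (Suc j)
       else real (a (Suc j)) + \<gamma> (Suc j) = real (k * b (Suc j)) + real k * \<gamma>' (Suc j))"
    if "j < n" for j
    unfolding P_def of_nat_mult distrib_left[symmetric] mult.assoc inv[OF that, symmetric]
    using mult_eq_iff_inverse_mult_eq[OF pos[OF that]]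
      mult_eq_iff_inverse_mult_eq[OF pos(2)[OF that] pos(1)[OF that]]
    by presburger
  have P_last: "P n" by (simp add: P_def last)
  have P_le: "P j" if "\<forall>i<n. P i" "j \<le> n" for j
    using that P_last by (cases "j = n") auto

  have ratio: "(\<forall>j<n. (even j \<longrightarrow> real k = \<gamma> j / \<gamma>' j) \<and> (odd j \<longrightarrow> real k = \<gamma>' j / \<gamma> j))
      \<longleftrightarrow> (\<forall>j<n. P j)"
  proof -
    have "(real k = \<gamma> j / \<gamma>' j \<longleftrightarrow> \<gamma> j = real k * \<gamma>' j)"
      "(real k = \<gamma>' j / \<gamma> j \<longleftrightarrow> \<gamma>' j = real k * \<gamma> j)" if "j < n" for j
      using pos[OF that] by (auto simp: field_simps)
    thus ?thesis unfolding P_def by blast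
  qed

  have "D j" if "\<forall>j\<le>n. P j" "j \<le> n" for j
  proof (cases j)
    case 0
    have "\<gamma> 0 = real k * \<gamma>' 0" using that by (auto simp: P_def)
    hence "real (a 0) = real (k * b 0)" using start by simp
    thus ?thesis unfolding 0 D_def of_nat_eq_iff by simp
  next
    \<comment> \<open>\<open>P i\<close> is an equation between digits plus tails at
      \<open>Suc i\<close>; subtracting the tail relation \<open>P (Suc i)\<close> leaves the digit
      relation.\<close>
    case (Suc i)
    hence "P i" "P (Suc i)" "i < n" using that by auto
    hence "if even i then real (b (Suc i)) = real (k * a (Suc i))
           else real (a (Suc i)) = real (k * b (Suc i))"
      unfolding P_step[OF \<open>i < n\<close>] P_def[of "Suc i"] by (cases "even i") simp_all
    thus ?thesis unfolding Suc D_def of_nat_eq_iff by (cases "even i") simp_all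
  qed
  moreover have "P j" if D: "\<forall>j\<le>n. D j" and "j \<le> n" for j
    using \<open>j \<le> n\<close>
  \<comment> \<open>Downward from \<open>n\<close>: adding the digit and tail relations at
    \<open>Suc j\<close> gives the equation that \<open>P_step\<close> equates with
    \<open>P j\<close>.\<close>
  proof (induction j rule: inc_induct)
    case base
    show ?case by (rule P_last)
  next
    case (step j)
    moreover have "D (Suc j)" using D step by simp
    ultimately show ?case
      unfolding P_step[OF \<open>j < n\<close>] P_def[of "Suc j"] D_def by (cases "even j") simp_all
  qed
  ultimately have perfect_iff: "perfect \<sigma> k a n \<longleftrightarrow> (\<forall>j<n. P j)"
    unfolding perfect_def D_def[unfolded b_def, symmetric] using P_le by (metis less_imp_le)

  have PQ: "Q j" if "\<forall>j<n. P j" "j < n" for j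
  proof -
    \<comment> \<open>\<open>P j\<close> rewrites each scaled argument of \<open>G\<close> as a tail
      of the other fraction, and \<open>P (Suc j)\<close> compares the resulting next tails. For
      \<open>j = n - 1\<close> this involves index \<open>n\<close>.\<close>
    have "P j" "P (Suc j)" using that P_le by auto
    hence "even j \<Longrightarrow> \<gamma> j = real k * \<gamma>' j \<and> \<gamma>' (Suc j) = real k * \<gamma> (Suc j)"
      "odd j \<Longrightarrow> \<gamma>' j = real k * \<gamma> j \<and> \<gamma> (Suc j) = real k * \<gamma>' (Suc j)"
      by (auto simp: P_def)
    moreover have "1 / real k * (real k * x) = x" for x using k by simp
    ultimately show ?thesis
      using G[of j] unfolding Q_def by (cases "even j") simp_all
  qed

  have QP: "P j" if Q: "\<forall>j<n. Q j" and "j < n" for j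
    using \<open>j < n\<close>
  proof (induction j)
    case 0
    have fl: "\<lfloor>1 / \<gamma>' 0\<rfloor> = int (b 1)"
      using inv(2)[OF 0] bounds(3,4)[of 1] 0 by (simp add: floor_eq_iff)
    have "int k dvd \<lfloor>1 / \<gamma>' 0\<rfloor>"
      using Q 0 pos[OF 0] k by (intro dvd_floor_if_G_mult) (auto simp: Q_def)
    hence "k dvd b 1" unfolding fl by simp
    moreover have "b 1 > 0" using can_b 0 by (simp add: canonical_def b_def)
    ultimately have "real k \<le> real (b 1)" by (simp add: dvd_imp_le)
    hence "real k \<le> 1 / \<gamma>' 0" using inv(2)[OF 0] bounds(3)[of 1] 0 by simp
    hence le: "real k * \<gamma>' 0 \<le> 1" using pos[OF 0] by (simp add: field_simps)
    have "real k * \<gamma>' 0 \<noteq> 1"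
    proof
      assume "real k * \<gamma>' 0 = 1"
      \<comment> \<open>The 1 is moved into the integer part, leaving fractional part 0 on the
        right; but \<gamma> is positive at index 0 since \<open>0 < n\<close>.\<close>
      hence "real (a 0) + \<gamma> 0 = real (k * b 0 + 1) + 0" using start by simp
      hence "\<gamma> 0 = 0"
        using bounds(1,2)[of 0] by (subst (asm) nat_plus_fraction_eq_iff) auto
      thus False using pos[OF 0] by simp
    qed
    hence "\<gamma> 0 = real k * \<gamma>' 0"
      using start le bounds[of 0] k by (subst (asm) nat_plus_fraction_eq_iff) auto
    thus ?case by (simp add: P_def)
  next
    case (Suc j)
    hence j: "j < n" and Pj: "P j" by auto
    have Qj: "Q j" using Q j by auto
    note bd = bounds[of "Suc j"]
    show ?case
    proof (cases "even j")
      case True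
      \<comment> \<open>By the second equation of \<open>Q j\<close> the left side is a value of
        \<open>G\<close>. With this bound the equation from \<open>P_step\<close> splits into digits
        and tails.\<close>
      have "real k * \<gamma> (Suc j) < 1"
        using Qj True G G_less_1[of "1 / real k * \<gamma> j"] by (simp add: Q_def)
      hence "\<gamma>' (Suc j) = real k * \<gamma> (Suc j)"
        using Pj True bd k j unfolding P_step[OF j]
        by (simp only: if_True, subst (asm) nat_plus_fraction_eq_iff) auto
      thus ?thesis using True by (simp add: P_def)
    next
      case False
      have "real k * \<gamma>' (Suc j) < 1"
        using Qj False G G_less_1[of "1 / real k * \<gamma>' j"] by (simp add: Q_def)
      hence "\<gamma> (Suc j) = real k * \<gamma>' (Suc j)"
        using Pj False bd k j unfolding P_step[OF j]
        by (simp only: if_False, subst (asm) nat_plus_fraction_eq_iff) auto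
      thus ?thesis using False by (simp add: P_def)
    qed
  qed

  show ?thesis
    unfolding ratio Q_def[symmetric] using perfect_iff PQ QP by blast
qed

end
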